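(* Let $n,K\ge 1$ be integers and consider the multi-server job queueing system with $n$ servers and $K$ job classes under the First-Come-First-Served (FCFS) policy, with class arrival rates $\lambda_i^{(n)}$, service rates $\mu_i$ and server needs $m_i^{(n)}$, $1\le i\le K$. Let $m_{\max}^{(n)}=\max_{1\le i\le K} m_i^{(n)}$ and $\rho^{(n)}=\sum_{i=1}^K \frac{\lambda_i^{(n)} m_i^{(n)}}{n\mu_i}$. If $$\rho^{(n)}<1-\frac{m_{\max}^{(n)}}{n},$$ then the continuous-time Markov chain $\mathbf U^{(n)}=\{\mathbf U^{(n)}(t), t\ge 0\}$ describing the state of the system is positive recurrent.
   Context: Multi-server job queueing model. There are $n$ identical servers and $K$ job classes. Jobs arrive according to a Poisson process of rate $\lambda^{(n)}>0$; each arrival is independently of class $i$ with probability $p_i^{(n)}>0$ ($\sum_i p_i^{(n)}=1$), so class $i$ jobs arrive as a Poisson process of rate $\lambda_i^{(n)}=\lambda^{(n)}p_i^{(n)}$. A class $i$ job has server need $m_i^{(n)}$, an integer with $1\le m_i^{(n)}\le n$: it occupies $m_i^{(n)}$ servers simultaneously for its whole service time. Service times are independent, independent of arrivals, and exponentially distributed with rate $\mu_i>0$ for class $i$. FCFS policy: arriving jobs join a single FCFS queue of infinite capacity. An arriving job enters service immediately if the queue is empty and the number of idle servers is at least its server need; otherwise it waits in the queue. Jobs enter service in arrival order: the head-of-queue job enters service as soon as the number of idle servers is at least its server need, and while it cannot enter service it blocks all jobs behind it. State: $\mathbf U^{(n)}(t)=(u_1(t),\dots,u_J(t))$ is the list of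 the classes of all jobs in the system (in queue plus in service) at time $t$, in arrival order, so $u_j(t)$ is the class of the $j$th oldest job. The state space is $\mathcal U=\{(u_1,\dots,u_J): J\in\{0,1,2,\dots\},\ u_j\in\{1,\dots,K\}\}$ (including the empty list). In state $u$, the jobs in service are those in the longest prefix $(u_1,\dots,u_k)$ with $\sum_{j=1}^k m_{u_j}^{(n)}\le n$. Transitions: a class $i$ is appended at the end of the list at rate $\lambda_i^{(n)}$, and each job in service, of class $i$ say, is removed from the list at rate $\mu_i$. This is an irreducible continuous-time Markov chain. *)

theory Defs
  imports "HOL-Probability.Probability"
begin

section \<open>Continuous-time Markov chains with given transition rates\<close>

text \<open>
  A chain on the state space \<open>S\<close> is given by the rates \<open>q x y\<close> of its transitions from \<open>x\<close> to
  \<open>y \<noteq> x\<close>; the diagonal of \<open>q\<close> plays no role. The total rate out of every state is meant to be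
  finite and positive (no absorbing states).
\<close>

definition exit_rate :: "'s set \<Rightarrow> ('s \<Rightarrow> 's \<Rightarrow> real) \<Rightarrow> 's \<Rightarrow> real" where
  "exit_rate S q x = (\<Sum>\<^sub>\<infinity>y\<in>S - {x}. q x y)"

definition jump_prob :: "'s set \<Rightarrow> ('s \<Rightarrow> 's \<Rightarrow> real) \<Rightarrow> 's \<Rightarrow> 's \<Rightarrow> real" where
  "jump_prob S q x y = (if y = x then 0 else q x y / exit_rate S q x)"

text \<open>
  \<open>U\<close> is, under the probability measure \<open>M\<close>, a Markov chain with rates \<open>q\<close> started in \<open>x\<close>:
  its successive states \<open>Y 0, Y 1, \<dots>\<close> form a discrete-time Markov chain with transition
  probabilities \<open>jump_prob\<close>, and given these states the holding times \<open>H 0, H 1, \<dots>\<close> are independent,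
  \<open>H j\<close> being exponential with rate \<open>exit_rate S q (Y j)\<close>. The displayed probabilities determine
  the joint law of \<open>Y\<close> and \<open>H\<close>. Nothing is required of \<open>U\<close> after a possible explosion.
\<close>

definition ctmc_from ::
    "'s set \<Rightarrow> ('s \<Rightarrow> 's \<Rightarrow> real) \<Rightarrow> 's \<Rightarrow> 'a measure \<Rightarrow> (real \<Rightarrow> 'a \<Rightarrow> 's) \<Rightarrow> bool" where
  "ctmc_from S q x M U \<longleftrightarrow>
     prob_space M \<and>
     (\<forall>t\<ge>0. U t \<in> measurable M (count_space S)) \<and>
     (\<exists>(Y :: nat \<Rightarrow> 'a \<Rightarrow> 's) (H :: nat \<Rightarrow> 'a \<Rightarrow> real).
        (\<forall>k. Y k \<in> measurable M (count_space S)) \<and>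
        (\<forall>k. H k \<in> borel_measurable M) \<and>
        (\<forall>k y s. (\<forall>j\<le>k. y j \<in> S \<and> 0 \<le> s j) \<longrightarrow>
           measure M {\<omega> \<in> space M. \<forall>j\<le>k. Y j \<omega> = y j \<and> s j < H j \<omega>} =
             (if y 0 = x then 1 else 0) *
             (\<Prod>j<k. jump_prob S q (y j) (y (Suc j))) *
             (\<Prod>j\<le>k. exp (- exit_rate S q (y j) * s j))) \<and>
        (AE \<omega> in M. \<forall>t k. (\<Sum>j<k. H j \<omega>) \<le> t \<and> t < (\<Sum>j\<le>k. H j \<omega>) \<longrightarrow> U t \<omega> = Y k \<omega>))"

text \<open>
  A Markov chain is a process \<open>U\<close> together with a family of probability measures \<open>P x\<close>, one for
  each initial state \<open>x\<close>.
\<close>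

definition ctmc ::
    "'s set \<Rightarrow> ('s \<Rightarrow> 's \<Rightarrow> real) \<Rightarrow> ('s \<Rightarrow> 'a measure) \<Rightarrow> (real \<Rightarrow> 'a \<Rightarrow> 's) \<Rightarrow> bool" where
  "ctmc S q P U \<longleftrightarrow> (\<forall>x\<in>S. ctmc_from S q x (P x) U)"

text \<open>
  First time at which the path is in \<open>x\<close> after having been outside \<open>x\<close>; for a path started in \<open>x\<close>
  this is the first return to \<open>x\<close> after the first jump. It is \<open>\<infinity>\<close> if there is no return.
\<close>

definition return_time :: "(real \<Rightarrow> 'a \<Rightarrow> 's) \<Rightarrow> 's \<Rightarrow> 'a \<Rightarrow> ennreal" where
  "return_time U x \<omega> = Inf {ennreal t | t. \<exists>s. 0 \<le> s \<and> s < t \<and> U s \<omega> \<noteq> x \<and> U t \<omega> = x}"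

definition positive_recurrent ::
    "'s set \<Rightarrow> ('s \<Rightarrow> 'a measure) \<Rightarrow> (real \<Rightarrow> 'a \<Rightarrow> 's) \<Rightarrow> bool" where
  "positive_recurrent S P U \<longleftrightarrow> (\<forall>x\<in>S. (\<integral>\<^sup>+ \<omega>. return_time U x \<omega> \<partial>P x) < \<infinity>)"

section \<open>The multi-server job queue under FCFS\<close>

text \<open>A state lists the classes of all jobs in the system, oldest first.\<close>

definition job_states :: "nat \<Rightarrow> nat list set" where
  "job_states K = lists {1..K}"

definition num_in_service :: "nat \<Rightarrow> (nat \<Rightarrow> nat) \<Rightarrow> nat list \<Rightarrow> nat" where
  "num_in_service n m u = Max {k. k \<le> length u \<and> sum_list (map m (take k u)) \<le> n}"

definition remove_job :: "nat \<Rightarrow> nat list \<Rightarrow> nat list" where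
  "remove_job j u = take j u @ drop (Suc j) u"

text \<open>
  Departures of different jobs (for instance two adjacent ones of the same class) can lead to the
  same list; their rates add up.
\<close>

definition fcfs_rate ::
    "nat \<Rightarrow> nat \<Rightarrow> (nat \<Rightarrow> real) \<Rightarrow> (nat \<Rightarrow> real) \<Rightarrow> (nat \<Rightarrow> nat) \<Rightarrow> nat list \<Rightarrow> nat list \<Rightarrow> real" where
  "fcfs_rate n K lam mu m u v =
     (\<Sum>i\<in>{1..K}. if v = u @ [i] then lam i else 0) +
     (\<Sum>j<num_in_service n m u. if v = remove_job j u then mu (u ! j) else 0)"

end

theory Submission
  imports Defs
begin

text \<open>
  The expected work in the system, \<open>workload u = \<Sum>j. m (u ! j) / \<mu> (u ! j)\<close>, is a linear Lyapunov
  function. Work arrives at rate \<open>n \<rho>\<close> and is removed at a rate equal to the number of busy servers;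
  if more than \<open>n\<close> jobs are present then some job is blocked, so more than \<open>n - m_max\<close> servers are
  busy. Hence the drift is below a negative constant outside a finite set, and Foster's criterion
  applies.

  For Foster's criterion, the expected cost \<open>h k y\<close> of the first \<open>k\<close> steps before hitting \<open>x\<close> from
  \<open>y\<close> satisfies \<open>h k y \<le> V y + M k\<close>, where \<open>M k\<close> is the maximum of \<open>h k\<close> over the exceptional finite
  set. From there \<open>x\<close> is reached with positive probability, so \<open>M k \<le> b + (1 - \<delta>) M k\<close> with \<open>b\<close>
  and \<open>\<delta>\<close> independent of \<open>k\<close>.
\<close>

section \<open>Expected cost before hitting a state\<close>

text \<open>The indicator tests the landing state, not the starting one. Hence the
  \<open>j\<close>-th iterate applied to \<open>c\<close> is the expectation of \<open>c\<close>
  after \<open>j\<close> steps on the event that steps \<open>1\<close> to \<open>j\<close> all land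
  in \<open>D\<close>; the start itself may lie outside \<open>D\<close>.\<close>

definition taboo :: "'s set \<Rightarrow> ('s \<Rightarrow> 's \<Rightarrow> real) \<Rightarrow> 's set \<Rightarrow> ('s \<Rightarrow> ennreal) \<Rightarrow> 's \<Rightarrow> ennreal" where
  "taboo S p D g y = (\<integral>\<^sup>+ z. ennreal (p y z) * (indicator D z * g z) \<partial>count_space S)"

lemma taboo_add: "taboo S p D (\<lambda>z. f z + g z) y = taboo S p D f y + taboo S p D g y"
  by (simp add: taboo_def distrib_left nn_integral_add)

lemma taboo_sum: fixes k :: nat shows "taboo S p D (\<lambda>z. \<Sum>j<k. f j z) y = (\<Sum>j<k. taboo S p D (f j) y)"
  by (induction k) (simp_all add: taboo_add, simp add: taboo_def)

text \<open>Truncation to the times 0 to \<open>k - 1\<close> keeps the cost finite before any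
  uniform bound is known.\<close>

definition taboo_cost ::
    "'s set \<Rightarrow> ('s \<Rightarrow> 's \<Rightarrow> real) \<Rightarrow> 's set \<Rightarrow> ('s \<Rightarrow> ennreal) \<Rightarrow> nat \<Rightarrow> 's \<Rightarrow> ennreal" where
  "taboo_cost S p D c k y = (\<Sum>j<k. (taboo S p D ^^ j) c y)"

lemma taboo_cost_0 [simp]: "taboo_cost S p D c 0 y = 0"
  by (simp add: taboo_cost_def)

text \<open>First-step analysis: the term \<open>j = 0\<close> is split off and one application of
  the operator is pulled out of the remaining sum.\<close>

lemma taboo_cost_Suc:
  "taboo_cost S p D c (Suc k) y = c y + taboo S p D (taboo_cost S p D c k) y"
  unfolding taboo_cost_def
  by (subst sum.lessThan_Suc_shift) (simp add: taboo_sum[symmetric])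

lemma taboo_cost_mono: "taboo_cost S p D c k y \<le> taboo_cost S p D c (Suc k) y"
  by (simp add: taboo_cost_def)

text \<open>The data of Foster's criterion for a discrete-time kernel. The transitive closure in
  \<open>reach\<close> asks for at least one step, also from \<open>x\<close> itself, because a
  return is at stake.\<close>

locale foster =
  fixes S :: "'s set" and p :: "'s \<Rightarrow> 's \<Rightarrow> real" and c V :: "'s \<Rightarrow> ennreal"
    and C :: "'s set" and B :: ennreal and x :: 's
  assumes p_nonneg: "\<And>y z. y \<in> S \<Longrightarrow> z \<in> S \<Longrightarrow> 0 \<le> p y z"
    and p_sum: "\<And>y. y \<in> S \<Longrightarrow> (\<integral>\<^sup>+ z. ennreal (p y z) \<partial>count_space S) \<le> 1"
    and V_finite: "\<And>y. y \<in> S \<Longrightarrow> V y < \<infinity>" and B_finite: "B < \<infinity>"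
    and C: "finite C" "C \<subseteq> S"
    and drift: "\<And>y. y \<in> S \<Longrightarrow>
      c y + (\<integral>\<^sup>+ z. ennreal (p y z) * V z \<partial>count_space S) \<le> V y + B * indicator C y"
    and x: "x \<in> S"
    and reach: "\<And>y. y \<in> C \<Longrightarrow> (y, x) \<in> {(u, v). u \<in> S \<and> v \<in> S \<and> 0 < p u v}\<^sup>+"
begin

section \<open>Bounds on the truncated cost\<close>

abbreviation "h \<equiv> taboo_cost S p (- {x}) c"

definition M :: "nat \<Rightarrow> ennreal" where "M k = (SUP y\<in>C. h k y)"

lemma M_mono: "M k \<le> M (Suc k)"
  unfolding M_def by (intro SUP_mono') (rule taboo_cost_mono)

lemma h_le_M: "y \<in> C \<Longrightarrow> h k y \<le> M k"
  unfolding M_def by (rule SUP_upper)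

text \<open>The recursion combined with the drift inequality: \<open>V\<close> absorbs the cost, and
  the constant \<open>b\<close> passes through because \<open>p y\<close> has mass at most 1. With
  \<open>a = 0\<close> this gives additive bounds; with \<open>f\<close> lowered at one state it
  gives the contraction.\<close>

lemma h_Suc_le:
  assumes "y \<in> S" and *: "\<And>z. z \<in> S \<Longrightarrow> indicator (- {x}) z * h k z \<le> V z + (b + a * ennreal (f z))"
  shows "h (Suc k) y \<le> V y + B * indicator C y
           + (b + a * (\<integral>\<^sup>+ z. ennreal (p y z) * ennreal (f z) \<partial>count_space S))"
proof -
  have "h (Suc k) y \<le> c y + (\<integral>\<^sup>+ z. ennreal (p y z) * (V z + (b + a * ennreal (f z))) \<partial>count_space S)"
    unfolding taboo_cost_Suc by (subst taboo_def) (intro add_left_mono nn_integral_mono mult_left_mono *, auto)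
  also have "(\<integral>\<^sup>+ z. ennreal (p y z) * (V z + (b + a * ennreal (f z))) \<partial>count_space S) =
      (\<integral>\<^sup>+ z. ennreal (p y z) * V z + (b * ennreal (p y z)
        + a * (ennreal (p y z) * ennreal (f z))) \<partial>count_space S)"
    by (intro nn_integral_cong) (simp add: distrib_left mult_ac)
  also have "\<dots> = (\<integral>\<^sup>+ z. ennreal (p y z) * V z \<partial>count_space S)
      + (b * (\<integral>\<^sup>+ z. ennreal (p y z) \<partial>count_space S)
        + a * (\<integral>\<^sup>+ z. ennreal (p y z) * ennreal (f z) \<partial>count_space S))"
    by (simp add: nn_integral_add nn_integral_cmult)
  also have "c y + \<dots> \<le> (c y + (\<integral>\<^sup>+ z. ennreal (p y z) * V z \<partial>count_space S))
      + (b * 1 + a * (\<integral>\<^sup>+ z. ennreal (p y z) * ennreal (f z) \<partial>count_space S))"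
    unfolding add.assoc by (intro add_left_mono add_right_mono mult_left_mono p_sum assms) auto
  also have "\<dots> \<le> V y + B * indicator C y
      + (b + a * (\<integral>\<^sup>+ z. ennreal (p y z) * ennreal (f z) \<partial>count_space S))"
    using drift[OF assms(1)] by (simp add: add_right_mono)
  finally show ?thesis .
qed

text \<open>A crude bound that grows with \<open>k\<close>. It serves to make \<open>M k\<close>
  finite, so that \<open>M k\<close> may later be cancelled.\<close>

lemma h_finite:
  assumes "y \<in> S" shows "h k y \<le> V y + of_nat k * B"
  using assms
proof (induction k arbitrary: y)
  case (Suc k)
  have "h (Suc k) y \<le> V y + B * indicator C y
      + (of_nat k * B + 0 * (\<integral>\<^sup>+ z. ennreal (p y z) * ennreal 0 \<partial>count_space S))"
    by (rule h_Suc_le[OF Suc.prems]) (use Suc.IH in \<open>auto simp: indicator_def\<close>)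
  also have "\<dots> \<le> V y + B + of_nat k * B"
    by (auto simp: indicator_def intro!: add_right_mono)
  finally show ?case by (simp add: distrib_right add_ac)
qed simp

lemma M_finite: "M k < \<infinity>"
proof -
  have "M k \<le> (\<Sum>y\<in>C. V y + of_nat k * B)"
    unfolding M_def
  proof (rule SUP_least)
    fix y assume "y \<in> C"
    then have "h k y \<le> V y + of_nat k * B" using C by (intro h_finite) auto
    also have "\<dots> \<le> (\<Sum>y\<in>C. V y + of_nat k * B)"
      using C \<open>y \<in> C\<close> by (intro member_le_sum) auto
    finally show "h k y \<le> (\<Sum>y\<in>C. V y + of_nat k * B)" .
  qed
  also have "\<dots> < \<infinity>"
    using C V_finite B_finite by (auto simp: ennreal_mult_less_top of_nat_less_top)
  finally show ?thesis .
qed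

text \<open>No \<open>B\<close> accumulates here: off \<open>C\<close> the drift inequality has no
  error term, and on \<open>C\<close> the definition of \<open>M\<close> gives the bound
  outright.\<close>

lemma h_le: "y \<in> S \<Longrightarrow> h k y \<le> V y + M k"
proof (induction k arbitrary: y)
  case (Suc k)
  show ?case
  proof (cases "y \<in> C")
    case True
    then have "h (Suc k) y \<le> M (Suc k)" by (rule h_le_M)
    then show ?thesis by (simp add: add_increasing)
  next
    case False
    have "h (Suc k) y \<le> V y + B * indicator C y
      + (M k + 0 * (\<integral>\<^sup>+ z. ennreal (p y z) * ennreal 0 \<partial>count_space S))"
      by (rule h_Suc_le[OF Suc.prems]) (use Suc.IH in \<open>auto simp: indicator_def\<close>)
    also have "\<dots> \<le> V y + M (Suc k)"
      using False M_mono by (auto intro: add_left_mono)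
    finally show ?thesis .
  qed
qed simp

text \<open>
  By \<open>h_le\<close> the growth of \<open>h k\<close> in \<open>k\<close> is that of \<open>M k\<close>. A state from which the target \<open>x\<close> can be
  reached inherits only a fraction of it, because part of the mass is absorbed in \<open>x\<close>; for all
  states of the finite set \<open>C\<close> this bounds \<open>M k\<close> in terms of itself.
\<close>

definition contracted :: "'s \<Rightarrow> bool" where
  "contracted y \<longleftrightarrow> (\<exists>b<\<infinity>. \<exists>\<delta>. 0 < \<delta> \<and> \<delta> \<le> 1 \<and> (\<forall>k. h k y \<le> b + M k * ennreal (1 - \<delta>)))"

text \<open>The contraction travels backwards along an edge of positive probability: a saving
  \<delta> at \<open>z\<close> becomes a saving \<open>\<delta> * p y z\<close> at
  \<open>y\<close>.\<close>

lemma contracted_step: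
  assumes y: "y \<in> S" and z: "z \<in> S" "0 < p y z" and "z = x \<or> contracted z"
  shows "contracted y"
proof -
  obtain b \<delta> where b: "b < \<infinity>" and \<delta>: "0 < \<delta>" "\<delta> \<le> 1"
    and *: "\<And>k. indicator (- {x}) z * h k z \<le> b + M k * ennreal (1 - \<delta>)"
  proof (cases "z = x")
    case True
    \<comment> \<open>At the target the indicator kills the cost, so everything is saved.\<close>
    then show ?thesis by (intro that[of 0 1]) auto
  next
    case False
    then show ?thesis using assms(4) that unfolding contracted_def by (auto simp: indicator_def)
  qed
  \<comment> \<open>\<open>f w\<close> is the weight of \<open>M k\<close> in the bound at the
    successor \<open>w\<close>: \<open>1 - \<delta>\<close> at \<open>z\<close>, and 1 elsewhere by
    \<open>h_le\<close>.\<close>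
  define f where "f w = 1 - \<delta> * of_bool (w = z)" for w
  define I where "I = (\<integral>\<^sup>+ w. ennreal (p y w) * ennreal (f w) \<partial>count_space S)"
  \<comment> \<open>Adding the saved mass to the average weight \<open>I\<close> restores the total
    mass of \<open>p y\<close>, which is at most 1; this avoids subtraction in
    \<open>ennreal\<close>.\<close>
  have "I + ennreal (\<delta> * p y z) = I + (\<integral>\<^sup>+ w. ennreal (\<delta> * p y w) * indicator {z} w \<partial>count_space S)"
    using z by (subst nn_integral_indicator_singleton) auto
  also have "\<dots> = (\<integral>\<^sup>+ w. ennreal (p y w) * ennreal (f w) + ennreal (\<delta> * p y w) * indicator {z} w \<partial>count_space S)"
    unfolding I_def by (simp add: nn_integral_add)
  also have "\<dots> = (\<integral>\<^sup>+ w. ennreal (p y w) \<partial>count_space S)"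
  proof (rule nn_integral_cong)
    fix w assume "w \<in> space (count_space S)"
    then have "w \<in> S" by simp
    then show "ennreal (p y w) * ennreal (f w) + ennreal (\<delta> * p y w) * indicator {z} w = ennreal (p y w)"
      using p_nonneg[OF y, of w] \<delta> mult_left_le_one_le[of "p y w" \<delta>]
      by (auto simp: f_def indicator_def algebra_simps simp flip: ennreal_mult ennreal_plus)
  qed
  also have "\<dots> \<le> 1" by (rule p_sum[OF y])
  finally have I: "I + ennreal (\<delta> * p y z) \<le> 1" .
  have prod: "0 < \<delta> * p y z" using \<delta> z by simp
  have "\<delta> * p y z \<le> 1"
    using order_trans[OF _ I, of "ennreal (\<delta> * p y z)"] by (simp add: add_increasing)
  have I': "I \<le> ennreal (1 - \<delta> * p y z)"
  proof -
    have "I \<le> 1" using I by (rule order_trans[rotated]) simp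
    then have "I < \<infinity>" by (rule le_less_trans) simp
    then obtain i where i: "I = ennreal i" "0 \<le> i" by (cases I) auto
    with I prod show ?thesis by (simp flip: ennreal_plus add: ennreal_le_iff2)
  qed
  have **: "h k y \<le> (V y + B + b) + M k * ennreal (1 - \<delta> * p y z)" for k
  proof -
    \<comment> \<open>Passing to \<open>Suc k\<close> makes the recursion applicable and leaves the
      same index in \<open>M k\<close> on the right-hand side.\<close>
    have "h k y \<le> h (Suc k) y" by (rule taboo_cost_mono)
    also have "\<dots> \<le> V y + B * indicator C y + (b + M k * I)"
      unfolding I_def
    proof (rule h_Suc_le[OF y])
      fix w assume w: "w \<in> S"
      show "indicator (- {x}) w * h k w \<le> V w + (b + M k * ennreal (f w))"
      proof (cases "w = z")
        case True
        then have "f w = 1 - \<delta>" by (simp add: f_def)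
        with *[of k] True show ?thesis by (metis add_increasing zero_le)
      next
        case False
        have "indicator (- {x}) w * h k w \<le> V w + M k"
          using h_le[OF w, of k] by (auto simp: indicator_def)
        also have "\<dots> \<le> V w + (b + M k)" by (intro add_left_mono) (simp add: add_increasing)
        finally show ?thesis using False by (simp add: f_def)
      qed
    qed
    also have "\<dots> \<le> V y + B + (b + M k * ennreal (1 - \<delta> * p y z))"
      by (intro add_mono mult_left_mono I') (auto simp: indicator_def)
    finally show ?thesis by (simp add: add_ac)
  qed
  show ?thesis
    unfolding contracted_def
    using ** prod \<open>\<delta> * p y z \<le> 1\<close> b V_finite[OF y] B_finite
    by (intro exI[of _ "V y + B + b"] conjI exI[of _ "\<delta> * p y z"]) auto
qed

text \<open>Backward induction along the path to \<open>x\<close> given by \<open>reach\<close>, its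
  last edge being the case \<open>z = x\<close>.\<close>

lemma contracted: "y \<in> C \<Longrightarrow> contracted y"
  by (drule reach, induction rule: converse_trancl_induct) (auto intro: contracted_step x)

text \<open>At a state \<open>y\<close> attaining the maximum,
  \<open>M k \<le> b y + M k * (1 - \<delta> y)\<close>. Since \<open>M k\<close> is finite, this
  can be solved to \<open>M k \<le> b y / \<delta> y\<close>.\<close>

lemma M_bounded: "\<exists>b<\<infinity>. \<forall>k. M k \<le> b"
proof -
  from contracted obtain b \<delta> where
    b: "\<And>y. y \<in> C \<Longrightarrow> b y < \<infinity>" and \<delta>: "\<And>y. y \<in> C \<Longrightarrow> 0 < \<delta> y \<and> \<delta> y \<le> 1"
    and *: "\<And>y k. y \<in> C \<Longrightarrow> h k y \<le> b y + M k * ennreal (1 - \<delta> y)"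
    unfolding contracted_def by metis
  \<comment> \<open>The maximising state may vary with \<open>k\<close>; the sum over
    \<open>C\<close> covers every choice.\<close>
  define b' where "b' = (\<Sum>y\<in>C. b y / ennreal (\<delta> y))"
  have "M k \<le> b'" for k
  proof (cases "C = {}")
    case True
    then show ?thesis unfolding M_def by simp
  next
    case False
    then have "M k \<in> h k ` C"
      unfolding M_def using C by (metis Max_Sup Max_in finite_imageI image_is_empty)
    then obtain y where y: "y \<in> C" "M k = h k y" by auto
    obtain a where a: "M k = ennreal a" "0 \<le> a" using M_finite[of k] by (cases "M k") auto
    obtain a' where a': "b y = ennreal a'" "0 \<le> a'" using b[OF y(1)] by (cases "b y") auto
    have "M k \<le> b y + M k * ennreal (1 - \<delta> y)" using *[OF y(1), of k] y(2) by simp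
    then have "a \<le> a' + a * (1 - \<delta> y)"
      using a a' \<delta>[OF y(1)] by (simp add: ennreal_le_iff flip: ennreal_mult ennreal_plus)
    then have "a \<le> a' / \<delta> y" using \<delta>[OF y(1)] by (simp add: field_simps)
    then have "M k \<le> b y / ennreal (\<delta> y)"
      using a a' \<delta>[OF y(1)] by (simp add: divide_ennreal ennreal_leI)
    also have "\<dots> \<le> b'" unfolding b'_def using C y by (intro member_le_sum) auto
    finally show ?thesis .
  qed
  moreover have "b' < \<infinity>"
    using C b \<delta> unfolding b'_def
    by (force simp: ennreal_divide_eq_top_iff less_top[symmetric] ennreal_eq_0_iff not_le)
  ultimately show ?thesis by blast
qed

text \<open>The partial sums are \<open>h k x\<close>, which \<open>h_le\<close> and the bound on
  \<open>M\<close> keep below \<open>V x + b\<close> uniformly in \<open>k\<close>.\<close>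

theorem taboo_cost_summable: "(\<Sum>j. (taboo S p (- {x}) ^^ j) c x) < \<infinity>"
proof -
  obtain b where b: "b < \<infinity>" "\<And>k. M k \<le> b" using M_bounded by blast
  have "(\<Sum>j. (taboo S p (- {x}) ^^ j) c x) = (SUP k. h k x)"
    by (simp add: suminf_eq_SUP taboo_cost_def)
  also have "\<dots> \<le> V x + b"
    by (intro SUP_least order_trans[OF h_le[OF x]] add_left_mono b)
  also have "\<dots> < \<infinity>" using b V_finite[OF x] by simp
  finally show ?thesis .
qed

end

section \<open>Jump chains with exponential holding times\<close>

text \<open>The jumps and holding times provided by \<open>ctmc_from\<close>, separated from
  \<open>U\<close>, which enters only when the return time is compared with the excursion
  cost.\<close>

locale jump_chain = prob_space M for M :: "'a measure" +
  fixes S :: "'s set" and q :: "'s \<Rightarrow> 's \<Rightarrow> real" and x :: 's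
    and Y :: "nat \<Rightarrow> 'a \<Rightarrow> 's" and H :: "nat \<Rightarrow> 'a \<Rightarrow> real"
  assumes S: "countable S" and x: "x \<in> S"
    and jump_nonneg: "\<And>y z. y \<in> S \<Longrightarrow> z \<in> S \<Longrightarrow> 0 \<le> jump_prob S q y z"
    and jump_sum: "\<And>y. y \<in> S \<Longrightarrow> (\<integral>\<^sup>+ z. ennreal (jump_prob S q y z) \<partial>count_space S) = 1"
    and exit_pos: "\<And>y. y \<in> S \<Longrightarrow> 0 < exit_rate S q y"
    and Y [measurable]: "\<And>k. Y k \<in> measurable M (count_space S)"
    and H [measurable]: "\<And>k. H k \<in> borel_measurable M"
    and law: "\<And>k y s. (\<And>j. j \<le> k \<Longrightarrow> y j \<in> S \<and> 0 \<le> s j) \<Longrightarrow>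
           measure M {\<omega> \<in> space M. \<forall>j\<le>k. Y j \<omega> = y j \<and> s j < H j \<omega>} =
             (if y 0 = x then 1 else 0) *
             (\<Prod>j<k. jump_prob S q (y j) (y (Suc j))) *
             (\<Prod>j\<le>k. exp (- exit_rate S q (y j) * s j))"
begin

section \<open>Laws of finite path segments\<close>

definition path_prob :: "nat \<Rightarrow> (nat \<Rightarrow> 's) \<Rightarrow> real" where
  "path_prob k y = (if y 0 = x then 1 else 0) * (\<Prod>j<k. jump_prob S q (y j) (y (Suc j)))"

definition on_path :: "nat \<Rightarrow> (nat \<Rightarrow> 's) \<Rightarrow> 'a \<Rightarrow> bool" where
  "on_path k y \<omega> \<longleftrightarrow> (\<forall>j\<le>k. Y j \<omega> = y j)"

lemma path_prob_nonneg: "(\<And>j. j \<le> k \<Longrightarrow> y j \<in> S) \<Longrightarrow> 0 \<le> path_prob k y"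
  unfolding path_prob_def by (auto intro!: prod_nonneg jump_nonneg)

lemma Y_eq_measurable [measurable]: "z \<in> S \<Longrightarrow> Measurable.pred M (\<lambda>\<omega>. Y k \<omega> = z)"
  using measurable_sets[OF Y[of k], of "{z}"]
  by (simp add: pred_def vimage_def Int_def conj_commute)

lemma Y_mem_measurable [measurable]: "Measurable.pred M (\<lambda>\<omega>. Y k \<omega> \<in> D)"
  using measurable_sets[OF Y[of k], of "D \<inter> S"] measurable_space[OF Y[of k]]
  by (auto simp: pred_def elim!: back_subst[of "\<lambda>A. A \<in> sets M"])

text \<open>\<open>law\<close> speaks only of events \<open>s j < H j\<close> with
  \<open>0 \<le> s j\<close>, so positivity of the holding times is carried along until it is known
  to hold almost surely.\<close>

lemma emeasure_path_tail:
  assumes "\<And>j. j \<le> k \<Longrightarrow> y j \<in> S" and "0 \<le> t"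
  shows "emeasure M {\<omega> \<in> space M. on_path k y \<omega> \<and> (\<forall>j\<le>k. 0 < H j \<omega>) \<and> t < H k \<omega>} =
     ennreal (path_prob k y) * ennreal (exp (- exit_rate S q (y k) * t))"
proof -
  \<comment> \<open>All thresholds but the last are 0, so only the factor of index \<open>k\<close>
    survives in the product.\<close>
  define s where "s j = (if j = k then t else 0)" for j
  have "{\<omega> \<in> space M. on_path k y \<omega> \<and> (\<forall>j\<le>k. 0 < H j \<omega>) \<and> t < H k \<omega>} =
      {\<omega> \<in> space M. \<forall>j\<le>k. Y j \<omega> = y j \<and> s j < H j \<omega>}"
    using assms(2) by (force simp: s_def on_path_def)
  moreover have "(\<Prod>j\<le>k. exp (- exit_rate S q (y j) * s j)) = exp (- exit_rate S q (y k) * t)"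
  proof -
    have "(\<Prod>j\<le>k. exp (- exit_rate S q (y j) * s j)) = (\<Prod>j\<in>{k}. exp (- exit_rate S q (y j) * s j))"
      by (rule prod.mono_neutral_right) (auto simp: s_def)
    then show ?thesis by (simp add: s_def)
  qed
  ultimately show ?thesis
    using law[of k y s] assms path_prob_nonneg[of k y]
    by (simp add: emeasure_eq_measure path_prob_def s_def ennreal_mult)
qed

text \<open>The Markov property in taboo form; \<open>c\<close> plays the part of the conditional
  mean of \<open>f (H k)\<close> given \<open>Y k\<close>. In the induction on \<open>d\<close>,
  fixing the next state lengthens the prefix, hence \<open>k\<close> and \<open>y\<close> are
  generalised.\<close>

lemma path_expectation:
  fixes f :: "real \<Rightarrow> ennreal"
  assumes f [measurable]: "f \<in> borel_measurable borel"
    and base: "\<And>k y. (\<And>j. j \<le> k \<Longrightarrow> y j \<in> S) \<Longrightarrow>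
       (\<integral>\<^sup>+ \<omega>. of_bool (on_path k y \<omega> \<and> (\<forall>j\<le>k. 0 < H j \<omega>)) * f (H k \<omega>) \<partial>M) = ennreal (path_prob k y) * c (y k)"
    and y: "\<And>j. j \<le> k \<Longrightarrow> y j \<in> S"
  shows "(\<integral>\<^sup>+ \<omega>. of_bool (on_path k y \<omega> \<and> (\<forall>j\<le>k + d. 0 < H j \<omega>) \<and> (\<forall>j\<in>{k<..k + d}. Y j \<omega> \<in> D))
      * f (H (k + d) \<omega>) \<partial>M) = ennreal (path_prob k y) * (taboo S (jump_prob S q) D ^^ d) c (y k)"
  using y
proof (induction d arbitrary: k y)
  case 0
  then show ?case using base[of k y] by simp
next
  case (Suc d)
  let ?T = "taboo S (jump_prob S q) D"
  let ?F = "\<lambda>k d y \<omega>. of_bool (on_path k y \<omega> \<and> (\<forall>j\<le>k + d. 0 < H j \<omega>) \<and> (\<forall>j\<in>{k<..k + d}. Y j \<omega> \<in> D))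
      * f (H (k + d) \<omega>)"
  note [measurable] = Suc.prems
  have meas: "?F (Suc k) d (y(Suc k := z)) \<in> borel_measurable M" if [measurable]: "z \<in> S" for z
  proof -
    have [measurable]: "(y(Suc k := z)) j \<in> S" if "j \<le> Suc k" for j
      using that Suc.prems[of j] \<open>z \<in> S\<close> by (auto simp: le_Suc_eq)
    have "Measurable.pred M (\<lambda>\<omega>. on_path (Suc k) (y(Suc k := z)) \<omega> \<and> (\<forall>j\<le>Suc k + d. 0 < H j \<omega>)
        \<and> (\<forall>j\<in>{Suc k<..Suc k + d}. Y j \<omega> \<in> D))"
      unfolding on_path_def by measurable
    then show ?thesis by measurable
  qed
  \<comment> \<open>The event is split by the value \<open>z\<close> of \<open>Y (Suc k)\<close>;
    for each \<omega> at most one summand is nonzero.\<close>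
  have "(\<integral>\<^sup>+ \<omega>. ?F k (Suc d) y \<omega> \<partial>M) =
      (\<integral>\<^sup>+ \<omega>. \<integral>\<^sup>+ z. indicator D z * ?F (Suc k) d (y(Suc k := z)) \<omega> \<partial>count_space S \<partial>M)"
  proof (rule nn_integral_cong)
    fix \<omega> assume "\<omega> \<in> space M"
    then have Yk: "Y (Suc k) \<omega> \<in> S" by (rule measurable_space[OF Y, simplified])
    have "(\<integral>\<^sup>+ z. indicator D z * ?F (Suc k) d (y(Suc k := z)) \<omega> \<partial>count_space S) =
      (\<Sum>z\<in>{Y (Suc k) \<omega>}. indicator D z * ?F (Suc k) d (y(Suc k := z)) \<omega>)"
      using Yk by (intro nn_integral_count_space') (auto simp: on_path_def)
    also have "\<dots> = ?F k (Suc d) y \<omega>"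
    proof -
      have "{k<..k + Suc d} = insert (Suc k) {Suc k<..Suc k + d}" by auto
      then show ?thesis
        by (auto simp: on_path_def le_Suc_eq indicator_def of_bool_def)
    qed
    finally show "?F k (Suc d) y \<omega> =
      (\<integral>\<^sup>+ z. indicator D z * ?F (Suc k) d (y(Suc k := z)) \<omega> \<partial>count_space S)" ..
  qed
  also have "\<dots> = (\<integral>\<^sup>+ z. \<integral>\<^sup>+ \<omega>. indicator D z * ?F (Suc k) d (y(Suc k := z)) \<omega> \<partial>M \<partial>count_space S)"
    by (intro nn_integral_count_space_nn_integral S borel_measurable_times_ennreal meas) auto
  also have "\<dots> = (\<integral>\<^sup>+ z. indicator D z * (ennreal (path_prob (Suc k) (y(Suc k := z))) * (?T ^^ d) c z) \<partial>count_space S)"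
  proof (rule nn_integral_cong)
    fix z assume "z \<in> space (count_space S)"
    then have z: "z \<in> S" by simp
    then have "(y(Suc k := z)) j \<in> S" if "j \<le> Suc k" for j
      using that Suc.prems[of j] by (auto simp: le_Suc_eq)
    then show "(\<integral>\<^sup>+ \<omega>. indicator D z * ?F (Suc k) d (y(Suc k := z)) \<omega> \<partial>M) =
        indicator D z * (ennreal (path_prob (Suc k) (y(Suc k := z))) * (?T ^^ d) c z)"
      using Suc.IH[of "Suc k" "y(Suc k := z)"] by (subst nn_integral_cmult[OF meas[OF z]]) (simp del: fun_upd_apply add: fun_upd_same)
  qed
  also have "\<dots> = (\<integral>\<^sup>+ z. ennreal (path_prob k y) * (ennreal (jump_prob S q (y k) z) * (indicator D z * (?T ^^ d) c z)) \<partial>count_space S)"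
  proof (rule nn_integral_cong)
    fix z assume "z \<in> space (count_space S)"
    then have "0 \<le> jump_prob S q (y k) z" using Suc.prems[of k] jump_nonneg by auto
    moreover have "path_prob (Suc k) (y(Suc k := z)) = path_prob k y * jump_prob S q (y k) z"
      unfolding path_prob_def by simp
    ultimately show "indicator D z * (ennreal (path_prob (Suc k) (y(Suc k := z))) * (?T ^^ d) c z) =
      ennreal (path_prob k y) * (ennreal (jump_prob S q (y k) z) * (indicator D z * (?T ^^ d) c z))"
      using path_prob_nonneg[OF Suc.prems] by (simp add: ennreal_mult mult_ac)
  qed
  also have "\<dots> = ennreal (path_prob k y) * (?T ^^ Suc d) c (y k)"
    by (subst nn_integral_cmult) (simp_all add: taboo_def)
  finally show ?case .
qed

lemma expectation_before_hit:
  fixes f :: "real \<Rightarrow> ennreal"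
  assumes f: "f \<in> borel_measurable borel"
    and base: "\<And>k y. (\<And>j. j \<le> k \<Longrightarrow> y j \<in> S) \<Longrightarrow>
       (\<integral>\<^sup>+ \<omega>. of_bool (on_path k y \<omega> \<and> (\<forall>j\<le>k. 0 < H j \<omega>)) * f (H k \<omega>) \<partial>M) = ennreal (path_prob k y) * c (y k)"
  shows "(\<integral>\<^sup>+ \<omega>. of_bool (Y 0 \<omega> = x \<and> (\<forall>j\<le>k. 0 < H j \<omega>) \<and> (\<forall>j\<in>{0<..k}. Y j \<omega> \<in> D))
      * f (H k \<omega>) \<partial>M) = (taboo S (jump_prob S q) D ^^ k) c x"
  using path_expectation[OF f base, of 0 "\<lambda>_. x" k D] x by (simp add: on_path_def path_prob_def)

lemma path_expectation_one:
  assumes "\<And>j. j \<le> k \<Longrightarrow> y j \<in> S"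
  shows "(\<integral>\<^sup>+ \<omega>. of_bool (on_path k y \<omega> \<and> (\<forall>j\<le>k. 0 < H j \<omega>)) * 1 \<partial>M) = ennreal (path_prob k y) * 1"
proof -
  note [measurable] = assms
  have [measurable]: "{\<omega> \<in> space M. on_path k y \<omega> \<and> (\<forall>j\<le>k. 0 < H j \<omega>)} \<in> sets M"
    unfolding on_path_def by measurable
  have "(\<integral>\<^sup>+ \<omega>. of_bool (on_path k y \<omega> \<and> (\<forall>j\<le>k. 0 < H j \<omega>)) * 1 \<partial>M) =
      (\<integral>\<^sup>+ \<omega>. indicator {\<omega> \<in> space M. on_path k y \<omega> \<and> (\<forall>j\<le>k. 0 < H j \<omega>)} \<omega> \<partial>M)"
    by (intro nn_integral_cong) (auto simp: indicator_def)
  also have "\<dots> = emeasure M {\<omega> \<in> space M. on_path k y \<omega> \<and> (\<forall>j\<le>k. 0 < H j \<omega>)}" by simp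
  also have "{\<omega> \<in> space M. on_path k y \<omega> \<and> (\<forall>j\<le>k. 0 < H j \<omega>)} =
     {\<omega> \<in> space M. on_path k y \<omega> \<and> (\<forall>j\<le>k. 0 < H j \<omega>) \<and> 0 < H k \<omega>}" by auto
  also have "emeasure M \<dots> = ennreal (path_prob k y) * 1"
    using emeasure_path_tail[of k y 0, OF assms] by simp
  finally show ?thesis .
qed

text \<open>The mean is the integral over \<open>t \<ge> 0\<close> of the probability of the tail
  \<open>t < H k\<close>, and by \<open>emeasure_path_tail\<close> these tails are
  exponential.\<close>

lemma path_expectation_holding:
  assumes y: "\<And>j. j \<le> k \<Longrightarrow> y j \<in> S"
  shows "(\<integral>\<^sup>+ \<omega>. of_bool (on_path k y \<omega> \<and> (\<forall>j\<le>k. 0 < H j \<omega>)) * ennreal (H k \<omega>) \<partial>M) =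
    ennreal (path_prob k y) * ennreal (1 / exit_rate S q (y k))"
proof -
  note [measurable] = assms
  let ?r = "exit_rate S q (y k)"
  have r: "0 < ?r" using y exit_pos by simp
  have [measurable]: "Measurable.pred M (on_path k y)"
    unfolding on_path_def by measurable
  interpret L: pair_sigma_finite lborel M
    by (intro pair_sigma_finite.intro sigma_finite_lborel sigma_finite_measure_axioms)
  let ?A = "\<lambda>t \<omega>. (0::real) \<le> t \<and> on_path k y \<omega> \<and> (\<forall>j\<le>k. 0 < H j \<omega>) \<and> t < H k \<omega>"
  have "(\<integral>\<^sup>+ \<omega>. of_bool (on_path k y \<omega> \<and> (\<forall>j\<le>k. 0 < H j \<omega>)) * ennreal (H k \<omega>) \<partial>M) =
      (\<integral>\<^sup>+ \<omega>. \<integral>\<^sup>+ t. indicator {t. ?A t \<omega>} t \<partial>lborel \<partial>M)"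
  proof (rule nn_integral_cong)
    fix \<omega>
    have "{t. ?A t \<omega>} = (if on_path k y \<omega> \<and> (\<forall>j\<le>k. 0 < H j \<omega>) then {0..<H k \<omega>} else {})"
      by auto
    then have "emeasure lborel {t. ?A t \<omega>} =
        of_bool (on_path k y \<omega> \<and> (\<forall>j\<le>k. 0 < H j \<omega>)) * ennreal (H k \<omega>)"
      by (auto intro: less_imp_le)
    moreover have "{t. ?A t \<omega>} \<in> sets lborel" by measurable
    ultimately show "of_bool (on_path k y \<omega> \<and> (\<forall>j\<le>k. 0 < H j \<omega>)) * ennreal (H k \<omega>) =
      (\<integral>\<^sup>+ t. indicator {t. ?A t \<omega>} t \<partial>lborel)" by simp
  qed
  also have "\<dots> = (\<integral>\<^sup>+ t. \<integral>\<^sup>+ \<omega>. indicator {t. ?A t \<omega>} t \<partial>M \<partial>lborel)"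
    by (rule L.Fubini') measurable
  \<comment> \<open>The tail is \<open>1 / ?r\<close> times the exponential density, whose total
    mass is 1.\<close>
  also have "\<dots> = (\<integral>\<^sup>+ t. ennreal (path_prob k y) * ennreal (1 / ?r) * ennreal (exponential_density ?r t) \<partial>lborel)"
  proof (rule nn_integral_cong)
    fix t :: real
    show "(\<integral>\<^sup>+ \<omega>. indicator {t. ?A t \<omega>} t \<partial>M) =
      ennreal (path_prob k y) * ennreal (1 / ?r) * ennreal (exponential_density ?r t)"
    proof (cases "0 \<le> t")
      case True
      have "(\<integral>\<^sup>+ \<omega>. indicator {t. ?A t \<omega>} t \<partial>M) = (\<integral>\<^sup>+ \<omega>. indicator {\<omega> \<in> space M. on_path k y \<omega> \<and> (\<forall>j\<le>k. 0 < H j \<omega>) \<and> t < H k \<omega>} \<omega> \<partial>M)"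
        using True by (intro nn_integral_cong) (auto simp: indicator_def)
      also have "\<dots> = emeasure M {\<omega> \<in> space M. on_path k y \<omega> \<and> (\<forall>j\<le>k. 0 < H j \<omega>) \<and> t < H k \<omega>}"
        by (rule nn_integral_indicator) measurable
      also have "\<dots> = ennreal (path_prob k y) * ennreal (exp (- ?r * t))"
        by (rule emeasure_path_tail[OF y True])
      finally show ?thesis
        using True r by (simp add: exponential_density_def mult.assoc mult.commute[of t] flip: ennreal_mult)
    next
      case False
      then show ?thesis by (simp add: exponential_density_def)
    qed
  qed
  also have "\<dots> = ennreal (path_prob k y) * ennreal (1 / ?r) * (\<integral>\<^sup>+ t. ennreal (exponential_density ?r t) \<partial>lborel)"
    by (rule nn_integral_cmult) simp
  also have "(\<integral>\<^sup>+ t. ennreal (exponential_density ?r t) \<partial>lborel) = 1"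
    using prob_space.emeasure_space_1[OF prob_space_exponential_density[OF r]]
    by (simp add: emeasure_density)
  finally show ?thesis by simp
qed

text \<open>With \<open>D = UNIV\<close> and unit cost, \<open>expectation_before_hit\<close> turns
  the probability of the event up to step \<open>k\<close> into an iterated total mass, which is 1
  by \<open>jump_sum\<close>.\<close>

lemma AE_start_and_holding_pos: "AE \<omega> in M. Y 0 \<omega> = x \<and> (\<forall>k. 0 < H k \<omega>)"
proof -
  note [measurable] = x
  have one: "(taboo S (jump_prob S q) UNIV ^^ k) (\<lambda>_. 1) y = 1" if "y \<in> S" for k y
    using that
  proof (induction k arbitrary: y)
    case (Suc k)
    have "(taboo S (jump_prob S q) UNIV ^^ Suc k) (\<lambda>_. 1) y =
        (\<integral>\<^sup>+ z. ennreal (jump_prob S q y z) \<partial>count_space S)"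
      by (simp add: taboo_def) (intro nn_integral_cong, simp add: Suc.IH)
    then show ?case using jump_sum[OF Suc.prems] by simp
  qed simp
  have "AE \<omega> in M. Y 0 \<omega> = x \<and> (\<forall>j\<le>k. 0 < H j \<omega>)" for k
  proof -
    have "emeasure M {\<omega> \<in> space M. Y 0 \<omega> = x \<and> (\<forall>j\<le>k. 0 < H j \<omega>)} =
        (\<integral>\<^sup>+ \<omega>. indicator {\<omega> \<in> space M. Y 0 \<omega> = x \<and> (\<forall>j\<le>k. 0 < H j \<omega>)} \<omega> \<partial>M)"
      by (subst nn_integral_indicator) auto
    also have "\<dots> = (\<integral>\<^sup>+ \<omega>. of_bool (Y 0 \<omega> = x \<and> (\<forall>j\<le>k. 0 < H j \<omega>) \<and> (\<forall>j\<in>{0<..k}. Y j \<omega> \<in> UNIV)) * 1 \<partial>M)"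
      by (intro nn_integral_cong) (auto simp: indicator_def)
    also have "\<dots> = 1"
      using expectation_before_hit[of "\<lambda>_. 1" "\<lambda>_. 1" k UNIV, OF _ path_expectation_one] one[OF x] by simp
    finally show ?thesis
      by (subst prob_Collect_eq_1[symmetric]) (auto simp: emeasure_eq_measure)
  qed
  then have "AE \<omega> in M. \<forall>k. Y 0 \<omega> = x \<and> (\<forall>j\<le>k. 0 < H j \<omega>)" by (simp add: AE_all_countable)
  then show ?thesis by eventually_elim auto
qed

text \<open>\<open>jump_prob\<close> vanishes on the diagonal. This matters because
  \<open>return_time\<close> counts a visit to \<open>x\<close> only after the path has been
  elsewhere.\<close>

lemma AE_first_jump: "AE \<omega> in M. Y 1 \<omega> \<noteq> x"
proof -
  note [measurable] = x
  have "(\<integral>\<^sup>+ \<omega>. of_bool (Y 0 \<omega> = x \<and> (\<forall>j\<le>1. 0 < H j \<omega>) \<and> (\<forall>j\<in>{0<..1}. Y j \<omega> \<in> {x})) * 1 \<partial>M) =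
      (taboo S (jump_prob S q) {x} ^^ 1) (\<lambda>_. 1) x"
    by (rule expectation_before_hit[OF _ path_expectation_one]) auto
  also have "\<dots> = 0"
    unfolding taboo_def by (auto simp: jump_prob_def indicator_def intro!: nn_integral_zero')
  finally have "AE \<omega> in M. (of_bool (Y 0 \<omega> = x \<and> (\<forall>j\<le>1. 0 < H j \<omega>) \<and> (\<forall>j\<in>{0<..1}. Y j \<omega> \<in> {x})) :: ennreal) = 0"
    by (subst (asm) nn_integral_0_iff_AE) auto
  with AE_start_and_holding_pos show ?thesis
  proof eventually_elim
    case (elim \<omega>)
    moreover have "{0<..1::nat} = {1}" by auto
    ultimately show ?case by simp
  qed
qed

text \<open>The summand \<open>1\<close> makes the sum infinite on the paths which do not return.\<close>

definition excursion_cost :: "'a \<Rightarrow> ennreal" where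
  "excursion_cost \<omega> = (\<Sum>k. of_bool (\<forall>j\<in>{0<..k}. Y j \<omega> \<noteq> x) * (1 + ennreal (H k \<omega>)))"

lemma expectation_excursion_cost:
  "(\<integral>\<^sup>+ \<omega>. excursion_cost \<omega> \<partial>M) =
    (\<Sum>k. (taboo S (jump_prob S q) (- {x}) ^^ k) (\<lambda>y. 1 + ennreal (1 / exit_rate S q y)) x)"
proof -
  note [measurable] = x
  have "(\<integral>\<^sup>+ \<omega>. excursion_cost \<omega> \<partial>M) =
      (\<Sum>k. (\<integral>\<^sup>+ \<omega>. of_bool (\<forall>j\<in>{0<..k}. Y j \<omega> \<noteq> x) * (1 + ennreal (H k \<omega>)) \<partial>M))"
    unfolding excursion_cost_def by (rule nn_integral_suminf) measurable
  moreover have "(\<integral>\<^sup>+ \<omega>. of_bool (\<forall>j\<in>{0<..k}. Y j \<omega> \<noteq> x) * (1 + ennreal (H k \<omega>)) \<partial>M) =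
      (taboo S (jump_prob S q) (- {x}) ^^ k) (\<lambda>y. 1 + ennreal (1 / exit_rate S q y)) x" for k
  proof -
    \<comment> \<open>The start in \<open>x\<close> and the positivity of holding times are almost
      sure, so they may be inserted to match \<open>expectation_before_hit\<close>.\<close>
    have "(\<integral>\<^sup>+ \<omega>. of_bool (\<forall>j\<in>{0<..k}. Y j \<omega> \<noteq> x) * (1 + ennreal (H k \<omega>)) \<partial>M) =
      (\<integral>\<^sup>+ \<omega>. of_bool (Y 0 \<omega> = x \<and> (\<forall>j\<le>k. 0 < H j \<omega>) \<and> (\<forall>j\<in>{0<..k}. Y j \<omega> \<in> - {x}))
        * (1 + ennreal (H k \<omega>)) \<partial>M)"
      by (rule nn_integral_cong_AE, use AE_start_and_holding_pos in eventually_elim) auto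
    also have "\<dots> = (taboo S (jump_prob S q) (- {x}) ^^ k) (\<lambda>y. 1 + ennreal (1 / exit_rate S q y)) x"
    proof (rule expectation_before_hit)
      fix k and y :: "nat \<Rightarrow> 's"
      assume y: "\<And>j. j \<le> k \<Longrightarrow> y j \<in> S"
      note [measurable] = y
      have "Measurable.pred M (on_path k y)" unfolding on_path_def by measurable
      then have [measurable]: "Measurable.pred M (on_path k y)" .
      have "(\<integral>\<^sup>+ \<omega>. of_bool (on_path k y \<omega> \<and> (\<forall>j\<le>k. 0 < H j \<omega>)) * (1 + ennreal (H k \<omega>)) \<partial>M) =
          (\<integral>\<^sup>+ \<omega>. of_bool (on_path k y \<omega> \<and> (\<forall>j\<le>k. 0 < H j \<omega>)) * 1 \<partial>M) +
          (\<integral>\<^sup>+ \<omega>. of_bool (on_path k y \<omega> \<and> (\<forall>j\<le>k. 0 < H j \<omega>)) * ennreal (H k \<omega>) \<partial>M)"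
        unfolding distrib_left by (rule nn_integral_add) measurable
      also have "\<dots> = ennreal (path_prob k y) * (1 + ennreal (1 / exit_rate S q (y k)))"
        unfolding distrib_left by (intro arg_cong2[where f = "(+)"] path_expectation_one path_expectation_holding y)
      finally show "(\<integral>\<^sup>+ \<omega>. of_bool (on_path k y \<omega> \<and> (\<forall>j\<le>k. 0 < H j \<omega>)) * (1 + ennreal (H k \<omega>)) \<partial>M) =
          ennreal (path_prob k y) * (1 + ennreal (1 / exit_rate S q (y k)))" .
    qed simp
    finally show ?thesis .
  qed
  ultimately show ?thesis by simp
qed

text \<open>If \<open>x\<close> is revisited, first at step \<open>N\<close>, the
  \<open>N\<close>-th jump time bounds the return time, and all holding times up to it are counted
  in the cost. Otherwise the cost is infinite.\<close>

lemma return_time_le_excursion_cost: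
  assumes "Y 1 \<omega> \<noteq> x" and H_pos: "\<And>k. 0 < H k \<omega>"
    and U: "\<And>t k. (\<Sum>j<k. H j \<omega>) \<le> t \<Longrightarrow> t < (\<Sum>j\<le>k. H j \<omega>) \<Longrightarrow> U t \<omega> = Y k \<omega>"
  shows "return_time U x \<omega> \<le> excursion_cost \<omega>"
proof (cases "\<exists>k>0. Y k \<omega> = x")
  case True
  define N where "N = (LEAST k. 0 < k \<and> Y k \<omega> = x)"
  have N: "0 < N" "Y N \<omega> = x" using LeastI_ex[OF True] by (auto simp: N_def)
  have before: "Y j \<omega> \<noteq> x" if "0 < j" "j < N" for j
    using not_less_Least[of j "\<lambda>k. 0 < k \<and> Y k \<omega> = x"] that by (auto simp: N_def)
  \<comment> \<open>The first jump leaves \<open>x\<close>, so jump 1 strictly precedes jump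
    \<open>N\<close>; these two times become the witnesses \<open>s\<close> and \<open>t\<close> in
    \<open>return_time\<close>.\<close>
  have "1 < N" using N assms(1) by (cases "N = 1") auto
  have at_jump: "U (\<Sum>j<k. H j \<omega>) \<omega> = Y k \<omega>" for k
    by (rule U) (simp_all add: H_pos flip: lessThan_Suc_atMost)
  have "(\<Sum>j<1. H j \<omega>) < (\<Sum>j<N. H j \<omega>)"
    by (rule sum_strict_mono2[of _ _ 1]) (use H_pos \<open>1 < N\<close> in \<open>auto intro: less_imp_le\<close>)
  moreover have "0 \<le> (\<Sum>j<1. H j \<omega>)" using H_pos by (intro sum_nonneg less_imp_le)
  ultimately have "return_time U x \<omega> \<le> ennreal (\<Sum>j<N. H j \<omega>)"
    unfolding return_time_def using at_jump[of 1] at_jump[of N] assms(1) N(2)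
    by (intro Inf_lower CollectI exI[of _ "\<Sum>j<N. H j \<omega>"] exI[of _ "\<Sum>j<1. H j \<omega>"] conjI refl)
      (simp_all del: sum.lessThan_Suc)
  also have "\<dots> = (\<Sum>j<N. ennreal (H j \<omega>))"
    using H_pos by (simp add: sum_ennreal less_imp_le)
  also have "\<dots> \<le> (\<Sum>k<N. of_bool (\<forall>j\<in>{0<..k}. Y j \<omega> \<noteq> x) * (1 + ennreal (H k \<omega>)))"
    using before by (intro sum_mono) auto
  also have "\<dots> \<le> excursion_cost \<omega>"
    unfolding excursion_cost_def by (rule sum_le_suminf) auto
  finally show ?thesis .
next
  case False
  then have never: "Y j \<omega> \<noteq> x" if "0 < j" for j
    using that by blast
  \<comment> \<open>Without a return, each of the first \<open>n\<close> summands is at least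
    1.\<close>
  have "of_nat n \<le> excursion_cost \<omega>" for n
  proof -
    have "of_nat n = (\<Sum>k<n. 1 :: ennreal)" by simp
    also have "\<dots> \<le> (\<Sum>k<n. of_bool (\<forall>j\<in>{0<..k}. Y j \<omega> \<noteq> x) * (1 + ennreal (H k \<omega>)))"
      using never by (intro sum_mono) auto
    also have "\<dots> \<le> excursion_cost \<omega>"
      unfolding excursion_cost_def by (rule sum_le_suminf) auto
    finally show ?thesis .
  qed
  then have "(SUP n. of_nat n) \<le> excursion_cost \<omega>" by (rule SUP_least)
  then show ?thesis by (simp add: ennreal_SUP_of_nat_eq_top top_unique)
qed

end

text \<open>Links \<open>has_sum\<close>, used for the rates, with the integrals over
  \<open>count_space\<close> in the taboo operator; nonnegativity turns summability into absolute
  summability.\<close>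

lemma nn_integral_count_space_has_sum:
  fixes f :: "'b \<Rightarrow> real"
  assumes "(f has_sum a) A" and "\<And>x. x \<in> A \<Longrightarrow> 0 \<le> f x"
  shows "(\<integral>\<^sup>+ x. ennreal (f x) \<partial>count_space A) = ennreal a"
proof -
  have "f summable_on A" using assms(1) by (rule has_sum_imp_summable)
  then have "(\<lambda>x. norm (f x)) summable_on A"
    using assms(2) by (subst summable_on_cong[of A _ f]) auto
  then have abs: "Infinite_Set_Sum.abs_summable_on f A" by (rule abs_summable_equivalent[THEN iffD1])
  then have "infsetsum f A = a"
    by (rule trans[OF infsetsum_infsum infsumI[OF assms(1)]])
  then show ?thesis using nn_integral_conv_infsetsum[OF abs assms(2)] by simp
qed

section \<open>Foster's criterion\<close>

text \<open>Reduction to the jump chain: dividing by the exit rate gives a drift inequality for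
  \<open>jump_prob\<close>, and the cost \<open>1 + 1 / exit_rate S q y\<close> is the mean
  contribution to \<open>excursion_cost\<close> of a step spent in \<open>y\<close>.\<close>

theorem foster_positive_recurrent:
  fixes V :: "'s \<Rightarrow> real"
  assumes S: "countable S"
    and q_nonneg: "\<And>y z. y \<in> S \<Longrightarrow> z \<in> S \<Longrightarrow> 0 \<le> q y z"
    and q_summable: "\<And>y. y \<in> S \<Longrightarrow> q y summable_on (S - {y})"
    and exit_pos: "\<And>y. y \<in> S \<Longrightarrow> 0 < exit_rate S q y"
    and exit_bound: "\<And>y. y \<in> S \<Longrightarrow> exit_rate S q y \<le> R"
    and V_nonneg: "\<And>y. y \<in> S \<Longrightarrow> 0 \<le> V y"
    and qV: "\<And>y. y \<in> S \<Longrightarrow> ((\<lambda>z. q y z * V z) has_sum QV y) (S - {y})"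
    and C: "finite C" "C \<subseteq> S"
    and \<epsilon>: "0 < \<epsilon>"
    and drift: "\<And>y. y \<in> S \<Longrightarrow> y \<notin> C \<Longrightarrow> QV y \<le> exit_rate S q y * V y - \<epsilon>"
    and reach: "\<And>x y. x \<in> S \<Longrightarrow> y \<in> C \<Longrightarrow> (y, x) \<in> {(u, v). u \<in> S \<and> v \<in> S \<and> u \<noteq> v \<and> 0 < q u v}\<^sup>+"
    and U: "ctmc S q P U"
  shows "positive_recurrent S P U"
  unfolding positive_recurrent_def
proof
  fix x assume x: "x \<in> S"
  \<comment> \<open>Chosen so that \<open>a * \<epsilon> = R + 1\<close>: off \<open>C\<close> the
    scaled function then drops per jump by at least \<open>(R + 1) / e \<ge> 1 + 1 / e\<close>,
    where \<open>e \<le> R\<close> is the exit rate.\<close>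
  define a where "a = (R + 1) / \<epsilon>"
  let ?p = "jump_prob S q" and ?e = "exit_rate S q"
  have R: "0 < R" using exit_pos[OF x] exit_bound[OF x] by simp
  then have a: "0 < a" using \<epsilon> by (simp add: a_def)
  have p_nonneg: "0 \<le> ?p y z" if "y \<in> S" "z \<in> S" for y z
    using q_nonneg[OF that] exit_pos[OF that(1)] by (simp add: jump_prob_def)
  have p_sum: "((\<lambda>z. ?p y z * f z) has_sum (s / ?e y)) S" if "y \<in> S" "((\<lambda>z. q y z * f z) has_sum s) (S - {y})" for y f s
  proof -
    have "((\<lambda>z. (q y z * f z) * (1 / ?e y)) has_sum (s * (1 / ?e y))) (S - {y})"
      by (rule has_sum_cmult_left[OF that(2)])
    then show ?thesis
      by (subst has_sum_cong_neutral[where T = "S - {y}" and g = "\<lambda>z. (q y z * f z) * (1 / ?e y)"])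
        (auto simp: jump_prob_def)
  qed
  have p_total: "(\<integral>\<^sup>+ z. ennreal (?p y z) \<partial>count_space S) = 1" if y: "y \<in> S" for y
  proof -
    have "(q y has_sum ?e y) (S - {y})"
      unfolding exit_rate_def by (rule has_sum_infsum[OF q_summable[OF y]])
    then have "(?p y has_sum 1) S"
      using p_sum[OF y, of "\<lambda>_. 1" "?e y"] exit_pos[OF y] by simp
    then show ?thesis using nn_integral_count_space_has_sum p_nonneg[OF y] by fastforce
  qed
  have pV: "(\<integral>\<^sup>+ z. ennreal (?p y z) * ennreal (a * V z) \<partial>count_space S) = ennreal (a * QV y / ?e y)"
    if y: "y \<in> S" for y
  proof -
    have "((\<lambda>z. q y z * (a * V z)) has_sum (a * QV y)) (S - {y})"
      using has_sum_cmult_right[OF qV[OF y], of a] by (simp add: mult_ac)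
    then have "(\<integral>\<^sup>+ z. ennreal (?p y z * (a * V z)) \<partial>count_space S) = ennreal (a * QV y / ?e y)"
      by (intro nn_integral_count_space_has_sum p_sum y) (use a p_nonneg[OF y] V_nonneg in auto)
    then show ?thesis
      using a p_nonneg[OF y] V_nonneg by (subst nn_integral_cong[where v = "\<lambda>z. ennreal (?p y z * (a * V z))"])
        (auto simp: ennreal_mult)
  qed
  \<comment> \<open>On \<open>C\<close> no decrease is assumed. The whole left-hand side of the
    drift inequality at each state of \<open>C\<close> is a summand of \<open>B\<close>.\<close>
  define B where "B = (\<Sum>y\<in>C. 1 + ennreal (1 / ?e y) + ennreal (a * QV y / ?e y))"
  interpret foster S ?p "\<lambda>y. 1 + ennreal (1 / ?e y)" "\<lambda>y. ennreal (a * V y)" C B x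
  proof
    fix y assume y: "y \<in> S"
    show "1 + ennreal (1 / ?e y) + (\<integral>\<^sup>+ z. ennreal (?p y z) * ennreal (a * V z) \<partial>count_space S)
       \<le> ennreal (a * V y) + B * indicator C y"
    proof (cases "y \<in> C")
      case True
      have "1 + ennreal (1 / ?e y) + ennreal (a * QV y / ?e y) \<le> B"
        unfolding B_def using C True by (intro member_le_sum) auto
      then show ?thesis using True by (simp add: pV[OF y] add_increasing)
    next
      case False
      have "QV y \<ge> 0"
        using has_sum_nonneg[OF qV[OF y]] q_nonneg[OF y] V_nonneg by auto
      have "a * QV y \<le> a * (?e y * V y - \<epsilon>)" using drift[OF y False] a by simp
      also have "\<dots> = a * V y * ?e y - (R + 1)" using \<epsilon> by (simp add: a_def field_simps)
      also have "\<dots> \<le> a * V y * ?e y - (?e y + 1)" using exit_bound[OF y] by simp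
      finally have "1 + 1 / ?e y + a * QV y / ?e y \<le> a * V y"
        using exit_pos[OF y] by (simp add: field_simps)
      then have "ennreal (1 + 1 / ?e y + a * QV y / ?e y) \<le> ennreal (a * V y)" by (rule ennreal_leI)
      then show ?thesis
        using False exit_pos[OF y] a \<open>QV y \<ge> 0\<close> by (simp add: pV[OF y] ennreal_plus flip: ennreal_1)
    qed
  next
    fix y assume "y \<in> C"
    have "{(u, v). u \<in> S \<and> v \<in> S \<and> u \<noteq> v \<and> 0 < q u v} \<subseteq> {(u, v). u \<in> S \<and> v \<in> S \<and> 0 < ?p u v}"
      using exit_pos by (auto simp: jump_prob_def)
    then show "(y, x) \<in> {(u, v). u \<in> S \<and> v \<in> S \<and> 0 < ?p u v}\<^sup>+"
      using reach[OF x \<open>y \<in> C\<close>] trancl_mono by blast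
  qed (use p_nonneg p_total C x in \<open>auto simp: B_def\<close>)
  have "ctmc_from S q x (P x) U" using U x by (simp add: ctmc_def)
  then obtain Y H where prob: "prob_space (P x)"
    and Y: "\<forall>k. Y k \<in> measurable (P x) (count_space S)"
    and H: "\<forall>k. H k \<in> borel_measurable (P x)"
    and law: "\<forall>k y s. (\<forall>j\<le>k. y j \<in> S \<and> 0 \<le> s j) \<longrightarrow>
        measure (P x) {\<omega> \<in> space (P x). \<forall>j\<le>k. Y j \<omega> = y j \<and> s j < H j \<omega>} =
          (if y 0 = x then 1 else 0) * (\<Prod>j<k. ?p (y j) (y (Suc j))) *
          (\<Prod>j\<le>k. exp (- ?e (y j) * s j))"
    and path: "AE \<omega> in P x. \<forall>t k. (\<Sum>j<k. H j \<omega>) \<le> t \<and> t < (\<Sum>j\<le>k. H j \<omega>) \<longrightarrow> U t \<omega> = Y k \<omega>"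
    unfolding ctmc_from_def by (elim conjE exE) (rule that)
  interpret J: jump_chain "P x" S q x Y H
    by (intro jump_chain.intro prob jump_chain_axioms.intro S x p_nonneg p_total exit_pos
        Y[rule_format] H[rule_format] law[rule_format])
  have "(\<integral>\<^sup>+ \<omega>. return_time U x \<omega> \<partial>P x) \<le> (\<integral>\<^sup>+ \<omega>. J.excursion_cost \<omega> \<partial>P x)"
  proof (rule nn_integral_mono_AE)
    show "AE \<omega> in P x. return_time U x \<omega> \<le> J.excursion_cost \<omega>"
      using J.AE_start_and_holding_pos J.AE_first_jump path
      by eventually_elim (rule J.return_time_le_excursion_cost, auto)
  qed
  also have "\<dots> < \<infinity>"
    unfolding J.expectation_excursion_cost by (rule taboo_cost_summable)
  finally show "(\<integral>\<^sup>+ \<omega>. return_time U x \<omega> \<partial>P x) < \<infinity>" .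
qed

section \<open>The FCFS queue\<close>

lemma length_remove_job: "j < length u \<Longrightarrow> length (remove_job j u) = length u - 1"
  by (simp add: remove_job_def)

lemma sum_list_map_remove_job:
  fixes f :: "nat \<Rightarrow> 'b::ab_group_add"
  assumes "j < length u"
  shows "sum_list (map f (remove_job j u)) = sum_list (map f u) - f (u ! j)"
proof -
  have "sum_list (map f u) = sum_list (map f (take j u @ u ! j # drop (Suc j) u))"
    using id_take_nth_drop[OF assms] by simp
  then show ?thesis by (simp add: remove_job_def)
qed

locale fcfs =
  fixes n K :: nat and lam \<mu> :: "nat \<Rightarrow> real" and m :: "nat \<Rightarrow> nat"
  assumes K: "1 \<le> K"
    and lam: "\<And>i. i \<in> {1..K} \<Longrightarrow> 0 < lam i"
    and \<mu>: "\<And>i. i \<in> {1..K} \<Longrightarrow> 0 < \<mu> i"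
    and m: "\<And>i. i \<in> {1..K} \<Longrightarrow> 1 \<le> m i \<and> m i \<le> n"
begin

section \<open>Jobs in service and busy servers\<close>

abbreviation "S \<equiv> job_states K"
abbreviation "q \<equiv> fcfs_rate n K lam \<mu> m"
abbreviation "served \<equiv> num_in_service n m"
abbreviation "busy u \<equiv> sum_list (map m (take (served u) u))"

lemma nth_class: "u \<in> S \<Longrightarrow> j < length u \<Longrightarrow> u ! j \<in> {1..K}"
  by (auto simp: job_states_def in_lists_conv_set)

lemma served:
  shows served_le_length: "served u \<le> length u" and busy_le: "busy u \<le> n"
    and served_max: "k \<le> length u \<Longrightarrow> sum_list (map m (take k u)) \<le> n \<Longrightarrow> k \<le> served u"
proof -
  let ?A = "{k. k \<le> length u \<and> sum_list (map m (take k u)) \<le> n}"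
  have fin: "finite ?A" by (rule finite_subset[of _ "{..length u}"]) auto
  have "0 \<in> ?A" by simp
  with fin have "served u \<in> ?A" unfolding num_in_service_def by (intro Max_in) auto
  then show "served u \<le> length u" "busy u \<le> n" by auto
  show "k \<le> length u \<Longrightarrow> sum_list (map m (take k u)) \<le> n \<Longrightarrow> k \<le> served u"
    unfolding num_in_service_def using fin by (intro Max_ge) auto
qed

lemma busy_eq: "busy u = (\<Sum>j<served u. m (u ! j))"
  using served_le_length[of u] by (simp add: sum_list_sum_nth min_absorb2 lessThan_atLeast0)

lemma served_le_n:
  assumes "u \<in> S" shows "served u \<le> n"
proof -
  have "served u = (\<Sum>j<served u. 1)" by simp
  also have "\<dots> \<le> (\<Sum>j<served u. m (u ! j))"
    using served_le_length[of u] nth_class[OF assms] m by (intro sum_mono) auto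
  also have "\<dots> \<le> n" using busy_le[of u] by (simp add: busy_eq)
  finally show ?thesis .
qed

text \<open>More than \<open>n\<close> jobs cannot all be in service, as each needs a server. The
  first waiting job, at index \<open>served u\<close> because positions start at 0, does not fit
  into the idle servers, and its need is at most the maximum.\<close>

lemma busy_gt:
  assumes u: "u \<in> S" and "n < length u"
  shows "n < busy u + Max (m ` {1..K})"
proof -
  have k: "served u < length u" using served_le_n[OF u] assms(2) by simp
  have "n < sum_list (map m (take (Suc (served u)) u))"
    using served_max[of "Suc (served u)" u] k by force
  also have "\<dots> = busy u + m (u ! served u)"
    using k by (simp add: take_Suc_conv_app_nth)
  also have "m (u ! served u) \<le> Max (m ` {1..K})"
    using nth_class[OF u k] by (intro Max_ge) auto
  finally show ?thesis by simp
qed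

lemma served_pos:
  assumes "u \<in> S" "u \<noteq> []" shows "0 < served u"
proof -
  have "take 1 u = [u ! 0]" using assms(2) by (cases u) auto
  then show ?thesis
    using served_max[of 1 u] m[OF nth_class[OF assms(1), of 0]] assms(2)
    by (cases u) auto
qed

section \<open>Transition rates out of a state\<close>

lemma append_in_S: "u \<in> S \<Longrightarrow> i \<in> {1..K} \<Longrightarrow> u @ [i] \<in> S"
  by (simp add: job_states_def)

lemma remove_job_in_S: "u \<in> S \<Longrightarrow> remove_job j u \<in> S"
  by (auto simp: job_states_def remove_job_def in_lists_conv_set dest: in_set_takeD in_set_dropD)

lemma remove_job_neq: "j < served u \<Longrightarrow> remove_job j u \<noteq> u"
  using length_remove_job[of j u] served_le_length[of u] by force

lemma \<mu>_served: "u \<in> S \<Longrightarrow> j < served u \<Longrightarrow> 0 < \<mu> (u ! j)"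
  using nth_class[of u j] served_le_length[of u] \<mu> by auto

lemma rate_nonneg: "u \<in> S \<Longrightarrow> 0 \<le> q u v"
  unfolding fcfs_rate_def using lam \<mu>_served[of u]
  by (intro add_nonneg_nonneg sum_nonneg) (auto intro: less_imp_le)

text \<open>Turns a sum over target lists, of which only finitely many have a nonzero rate, into a
  sum over arrivals and departures.\<close>

lemma has_sum_rate:
  fixes f :: "nat list \<Rightarrow> real"
  assumes u: "u \<in> S"
  shows "((\<lambda>v. q u v * f v) has_sum
    ((\<Sum>i\<in>{1..K}. lam i * f (u @ [i])) + (\<Sum>j<served u. \<mu> (u ! j) * f (remove_job j u)))) (S - {u})"
proof (rule has_sum_finite_neutralI)
  let ?T = "(\<lambda>i. u @ [i]) ` {1..K} \<union> (\<lambda>j. remove_job j u) ` {..<served u}"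
  show fin: "finite ?T" by simp
  show "?T \<subseteq> S - {u}"
    using append_in_S[OF u] remove_job_in_S[OF u] remove_job_neq by auto
  show "q u v * f v = 0" if "v \<in> S - {u} - ?T" for v
  proof -
    have "(\<Sum>i\<in>{1..K}. if v = u @ [i] then lam i else 0) = 0"
      "(\<Sum>j<served u. if v = remove_job j u then \<mu> (u ! j) else 0) = 0"
      using that by (auto intro!: sum.neutral)
    then have "q u v = 0" unfolding fcfs_rate_def by simp
    then show ?thesis by simp
  qed
  \<comment> \<open>Different events may lead to the same list, so \<open>g\<close> may fail to be
    injective: the two sums are exchanged instead of reindexed.\<close>
  have delta: "(\<Sum>v\<in>?T. (\<Sum>i\<in>I. if v = g i then r i else 0) * f v) = (\<Sum>i\<in>I. r i * f (g i))"
    if "g ` I \<subseteq> ?T" for I and g :: "nat \<Rightarrow> nat list" and r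
  proof -
    have "(\<Sum>v\<in>?T. (\<Sum>i\<in>I. if v = g i then r i else 0) * f v) =
        (\<Sum>v\<in>?T. \<Sum>i\<in>I. if v = g i then r i * f v else 0)"
      unfolding sum_distrib_right by (intro sum.cong) auto
    also have "\<dots> = (\<Sum>i\<in>I. \<Sum>v\<in>?T. if v = g i then r i * f v else 0)" by (rule sum.swap)
    also have "\<dots> = (\<Sum>i\<in>I. r i * f (g i))"
      using that by (intro sum.cong refl, subst sum.delta[OF fin]) auto
    finally show ?thesis .
  qed
  show "(\<Sum>i\<in>{1..K}. lam i * f (u @ [i])) + (\<Sum>j<served u. \<mu> (u ! j) * f (remove_job j u)) = (\<Sum>v\<in>?T. q u v * f v)"
    unfolding fcfs_rate_def distrib_right sum.distrib by (subst (1 2) delta) auto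
qed

lemma exit_rate_eq:
  assumes "u \<in> S"
  shows "exit_rate S q u = (\<Sum>i\<in>{1..K}. lam i) + (\<Sum>j<served u. \<mu> (u ! j))"
  unfolding exit_rate_def using infsumI[OF has_sum_rate[OF assms, of "\<lambda>_. 1"]] by simp

lemma lam_total_pos: "0 < (\<Sum>i\<in>{1..K}. lam i)"
  using K lam by (intro sum_pos) auto

lemma exit_rate_pos: "u \<in> S \<Longrightarrow> 0 < exit_rate S q u"
  unfolding exit_rate_eq using \<mu>_served[of u]
  by (intro add_pos_nonneg lam_total_pos sum_nonneg) (auto intro: less_imp_le)

text \<open>At most \<open>n\<close> jobs are in service, each at a rate at most the sum of all
  \<open>\<mu> i\<close>. This is the uniform bound \<open>R\<close> in Foster's criterion.\<close>

lemma exit_rate_le: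
  assumes u: "u \<in> S"
  shows "exit_rate S q u \<le> (\<Sum>i\<in>{1..K}. lam i) + real n * (\<Sum>i\<in>{1..K}. \<mu> i)"
proof -
  have "(\<Sum>j<served u. \<mu> (u ! j)) \<le> (\<Sum>j<served u. \<Sum>i\<in>{1..K}. \<mu> i)"
    using nth_class[OF u] served_le_length[of u] \<mu>
    by (intro sum_mono member_le_sum) (auto intro: less_imp_le)
  also have "\<dots> \<le> real n * (\<Sum>i\<in>{1..K}. \<mu> i)"
    using served_le_n[OF u] \<mu> by (auto intro!: mult_right_mono sum_nonneg intro: less_imp_le)
  finally show ?thesis by (simp add: exit_rate_eq[OF u])
qed

section \<open>Drift of the workload\<close>

definition workload :: "nat list \<Rightarrow> real" where
  "workload u = sum_list (map (\<lambda>i. real (m i) / \<mu> i) u)"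

lemma workload_nonneg: "u \<in> S \<Longrightarrow> 0 \<le> workload u"
  unfolding workload_def using \<mu>
  by (intro sum_list_nonneg) (auto simp: job_states_def in_lists_conv_set intro!: divide_nonneg_pos)

text \<open>
  A job of class \<open>i\<close> in service removes \<open>m i / \<mu> i\<close> at rate \<open>\<mu> i\<close>, so work leaves at a rate equal
  to the number of busy servers.
\<close>

lemma workload_generator:
  assumes u: "u \<in> S"
  shows "((\<lambda>v. q u v * workload v) has_sum
    (exit_rate S q u * workload u + (\<Sum>i\<in>{1..K}. lam i * real (m i) / \<mu> i) - real (busy u))) (S - {u})"
proof -
  have "(\<Sum>i\<in>{1..K}. lam i * workload (u @ [i])) =
      (\<Sum>i\<in>{1..K}. lam i) * workload u + (\<Sum>i\<in>{1..K}. lam i * real (m i) / \<mu> i)"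
    by (simp add: workload_def distrib_left sum.distrib sum_distrib_right)
  moreover have "(\<Sum>j<served u. \<mu> (u ! j) * workload (remove_job j u)) =
      (\<Sum>j<served u. \<mu> (u ! j)) * workload u - real (busy u)"
  proof -
    have "(\<Sum>j<served u. \<mu> (u ! j) * workload (remove_job j u)) =
        (\<Sum>j<served u. \<mu> (u ! j) * workload u - real (m (u ! j)))"
    proof (rule sum.cong[OF refl])
      fix j assume "j \<in> {..<served u}"
      then show "\<mu> (u ! j) * workload (remove_job j u) = \<mu> (u ! j) * workload u - real (m (u ! j))"
        using \<mu>_served[OF u, of j] served_le_length[of u]
        by (simp add: workload_def sum_list_map_remove_job right_diff_distrib)
    qed
    then show ?thesis by (simp add: busy_eq sum_subtractf sum_distrib_right)
  qed
  ultimately have "(\<Sum>i\<in>{1..K}. lam i * workload (u @ [i])) + (\<Sum>j<served u. \<mu> (u ! j) * workload (remove_job j u)) =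
      exit_rate S q u * workload u + (\<Sum>i\<in>{1..K}. lam i * real (m i) / \<mu> i) - real (busy u)"
    by (simp add: exit_rate_eq[OF u] distrib_right)
  with has_sum_rate[OF u, of workload] show ?thesis by simp
qed

section \<open>Irreducibility of the queue\<close>

abbreviation "edges \<equiv> {(u, v). u \<in> S \<and> v \<in> S \<and> u \<noteq> v \<and> 0 < q u v}"

lemma arrival_edge:
  assumes u: "u \<in> S" and i: "i \<in> {1..K}"
  shows "(u, u @ [i]) \<in> edges"
proof -
  have "0 < q u (u @ [i])"
    unfolding fcfs_rate_def
  proof (rule add_pos_nonneg)
    show "0 < (\<Sum>i'\<in>{1..K}. if u @ [i] = u @ [i'] then lam i' else 0)"
      using lam i by (intro sum_pos2[of _ i]) (auto intro: less_imp_le)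
    show "0 \<le> (\<Sum>j<served u. if u @ [i] = remove_job j u then \<mu> (u ! j) else 0)"
      using \<mu>_served[OF u] by (intro sum_nonneg) (auto intro: less_imp_le)
  qed
  then show ?thesis using u append_in_S[OF u i] by simp
qed

text \<open>The oldest job is always in service, since its need is at most \<open>n\<close>.\<close>

lemma departure_edge:
  assumes "a # u \<in> S"
  shows "(a # u, u) \<in> edges"
proof -
  have "0 < q (a # u) u"
    unfolding fcfs_rate_def
  proof (rule add_nonneg_pos)
    show "0 \<le> (\<Sum>i\<in>{1..K}. if u = (a # u) @ [i] then lam i else 0)"
      using lam by (intro sum_nonneg) (auto intro: less_imp_le)
    show "0 < (\<Sum>j<served (a # u). if u = remove_job j (a # u) then \<mu> ((a # u) ! j) else 0)"
      using \<mu>_served[OF assms] served_pos[OF assms] \<mu>_served[OF assms, of 0]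
      by (intro sum_pos2[of _ 0]) (auto simp: remove_job_def intro: less_imp_le)
  qed
  then show ?thesis using assms by (auto simp: job_states_def)
qed

lemma drain: "u \<in> S \<Longrightarrow> (u, []) \<in> edges\<^sup>*"
proof (induction u)
  case (Cons a u)
  then have "(u, []) \<in> edges\<^sup>*" by (simp add: job_states_def)
  with departure_edge[OF Cons.prems] show ?case by (rule converse_rtrancl_into_rtrancl)
qed simp

lemma build: "u \<in> S \<Longrightarrow> ([], u) \<in> edges\<^sup>*"
proof (induction u rule: rev_induct)
  case (snoc a u)
  then have "u \<in> S" "a \<in> {1..K}" by (auto simp: job_states_def)
  with snoc.IH arrival_edge show ?case by (blast intro: rtrancl_into_rtrancl)
qed simp

text \<open>All jobs leave, oldest first, and then those of \<open>v\<close> arrive in order. The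
  extra arrival at the beginning guarantees at least one transition, even if \<open>u\<close> and
  \<open>v\<close> are both empty.\<close>

lemma irreducible:
  assumes "u \<in> S" "v \<in> S" shows "(u, v) \<in> edges\<^sup>+"
proof -
  have 1: "1 \<in> {1..K}" using K by simp
  have "(u @ [1], v) \<in> edges\<^sup>*"
    using drain[OF append_in_S[OF assms(1) 1]] build[OF assms(2)] by (rule rtrancl_trans)
  with arrival_edge[OF assms(1) 1] show ?thesis by (rule rtrancl_into_trancl2)
qed

theorem positive_recurrent:
  assumes load: "(\<Sum>i\<in>{1..K}. lam i * real (m i) / \<mu> i) < real n - real (Max (m ` {1..K}))"
    and U: "ctmc S q P U"
  shows "positive_recurrent S P U"
proof (rule foster_positive_recurrent[OF _ _ _ exit_rate_pos exit_rate_le workload_nonneg workload_generator])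
  let ?load = "\<Sum>i\<in>{1..K}. lam i * real (m i) / \<mu> i"
  \<comment> \<open>Outside this set more than \<open>n\<close> jobs are present, so
    \<open>busy_gt\<close> applies; the guaranteed decrease is the slack in the assumption
    \<open>load\<close>.\<close>
  let ?C = "{u. set u \<subseteq> {1..K} \<and> length u \<le> n}"
  show "0 < real n - real (Max (m ` {1..K})) - ?load" using load by simp
  show "finite ?C" by (rule finite_lists_length_le) simp
  show "?C \<subseteq> S" by (auto simp: job_states_def lists_eq_set)
  show "exit_rate S q u * workload u + ?load - real (busy u) \<le>
      exit_rate S q u * workload u - (real n - real (Max (m ` {1..K})) - ?load)"
    if "u \<in> S" "u \<notin> ?C" for u
    using busy_gt[OF that(1)] that by (auto simp: job_states_def lists_eq_set)
  show "(u, v) \<in> edges\<^sup>+" if "v \<in> S" "u \<in> ?C" for u v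
    using that by (intro irreducible) (auto simp: job_states_def lists_eq_set)
  show "q u summable_on (S - {u})" if "u \<in> S" for u
    using has_sum_imp_summable[OF has_sum_rate[OF that, of "\<lambda>_. 1"]] by simp
qed (auto intro: rate_nonneg U)

end

theorem theorem4p1:
  fixes n K :: nat
    and \<Lambda> :: real
    and p lam \<mu> :: "nat \<Rightarrow> real"
    and m :: "nat \<Rightarrow> nat"
    and m_max :: nat
    and \<rho> :: real
    and P :: "nat list \<Rightarrow> 'a measure"
    and U :: "real \<Rightarrow> 'a \<Rightarrow> nat list"
  assumes "n \<ge> 1" and "K \<ge> 1"
    and "\<Lambda> > 0"
    and "\<And>i. i \<in> {1..K} \<Longrightarrow> p i > 0" and "(\<Sum>i\<in>{1..K}. p i) = 1"
    and "\<And>i. i \<in> {1..K} \<Longrightarrow> lam i = \<Lambda> * p i"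
    and "\<And>i. i \<in> {1..K} \<Longrightarrow> \<mu> i > 0"
    and "\<And>i. i \<in> {1..K} \<Longrightarrow> 1 \<le> m i \<and> m i \<le> n"
    and "m_max = Max (m ` {1..K})"
    and "\<rho> = (\<Sum>i\<in>{1..K}. lam i * real (m i) / (real n * \<mu> i))"
    and "\<rho> < 1 - real m_max / real n"
    and "ctmc (job_states K) (fcfs_rate n K lam \<mu> m) P U"
  shows "positive_recurrent (job_states K) P U"
proof -
  interpret fcfs n K lam \<mu> m
    using assms by unfold_locales auto
  \<comment> \<open>Multiplying the stability condition by \<open>n\<close> turns it into the work
    balance required by the locale theorem.\<close>
  have "real n * \<rho> = (\<Sum>i\<in>{1..K}. lam i * real (m i) / \<mu> i)"
    using \<open>n \<ge> 1\<close> unfolding \<open>\<rho> = _\<close> sum_distrib_left by (intro sum.cong) auto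
  moreover have "real n * \<rho> < real n - real m_max"
    using \<open>n \<ge> 1\<close> \<open>\<rho> < _\<close> by (simp add: field_simps)
  ultimately show ?thesis
    using positive_recurrent assms by simp
qed

end
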